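(* A function $f\in\mathcal{A}$ belongs to the class $\mathcal{S}^*_{Ne}$ if, and only if, there exists an analytic function $q$ on $\mathbb{D}$ satisfying $q(z)\prec\varphi_{Ne}(z)=1+z-z^3/3$ such that $$f(z)=z\exp\left(\int_0^z\frac{q(\zeta)-1}{\zeta}\,d\zeta\right),\quad z\in\mathbb{D}.$$
   Context: $\mathbb{D}$ is the open unit disk. $\mathcal{A}$ is the set of analytic functions $f$ on $\mathbb{D}$ with $f(0)=0$ and $f'(0)=1$. For analytic $f,g$ on $\mathbb{D}$, $f\prec g$ ($f$ is subordinate to $g$) means there is an analytic $w$ on $\mathbb{D}$ with $w(0)=0$ and $|w(z)|<1$ such that $f(z)=g(w(z))$ for all $z\in\mathbb{D}$. $\varphi_{Ne}(z)=1+z-z^3/3$, and $\mathcal{S}^*_{Ne}=\{f\in\mathcal{A}: zf'(z)/f(z)\prec\varphi_{Ne}(z)\}$ (the quotient $zf'(z)/f(z)$ being analytic on $\mathbb{D}$, with value $1$ at $0$). *)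

theory Defs
  imports "HOL-Complex_Analysis.Complex_Analysis"
begin

abbreviation unit_disk :: "complex set" where
  "unit_disk \<equiv> ball 0 1"

definition normalized_analytic :: "(complex \<Rightarrow> complex) set" where
  "normalized_analytic = {f. f holomorphic_on unit_disk \<and> f 0 = 0 \<and> deriv f 0 = 1}"

definition subordinate :: "(complex \<Rightarrow> complex) \<Rightarrow> (complex \<Rightarrow> complex) \<Rightarrow> bool"
    (infix "\<prec>\<^sub>D" 50) where
  "f \<prec>\<^sub>D g \<longleftrightarrow>
     f holomorphic_on unit_disk \<and> g holomorphic_on unit_disk \<and>
     (\<exists>w. w holomorphic_on unit_disk \<and> w 0 = 0 \<and>
          (\<forall>z\<in>unit_disk. norm (w z) < 1) \<and>
          (\<forall>z\<in>unit_disk. f z = g (w z)))"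

definition phi_Ne :: "complex \<Rightarrow> complex" where
  "phi_Ne z = 1 + z - z ^ 3 / 3"

text \<open>The quotient \<open>z f'(z) / f(z)\<close>, with its removable singularity at \<open>0\<close> filled by
  the value \<open>1\<close>.  At a zero \<open>z \<noteq> 0\<close> of \<open>f\<close> in the disk the division convention
  \<open>x / 0 = 0\<close> does no harm below: for \<open>f\<close> in \<open>normalized_analytic\<close> the quotient is unbounded
  near such a point, hence not holomorphic, and so not subordinate to anything.\<close>
definition log_deriv_quotient :: "(complex \<Rightarrow> complex) \<Rightarrow> complex \<Rightarrow> complex" where
  "log_deriv_quotient f z = (if z = 0 then 1 else z * deriv f z / f z)"

definition starlike_Ne :: "(complex \<Rightarrow> complex) set" where
  "starlike_Ne = {f \<in> normalized_analytic. log_deriv_quotient f \<prec>\<^sub>D phi_Ne}"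

text \<open>The integral \<open>\<integral>\<^sub>0\<^sup>z (q(\<zeta>) - 1) / \<zeta> d\<zeta>\<close>, taken along the segment from \<open>0\<close> to \<open>z\<close>.
  When \<open>q\<close> is holomorphic on the disk with \<open>q 0 = 1\<close>, the integrand has a removable
  singularity at \<open>0\<close>; its formal value at that single point does not affect the integral.\<close>
definition radial_integral :: "(complex \<Rightarrow> complex) \<Rightarrow> complex \<Rightarrow> complex" where
  "radial_integral q z = contour_integral (linepath 0 z) (\<lambda>\<zeta>. (q \<zeta> - 1) / \<zeta>)"

end

theory Submission
  imports Defs
begin

text \<open>Let \<open>Q(z)\<close> be the radial integral of \<open>q\<close>, so that \<open>z Q'(z) = q(z) - 1\<close>. If
  \<open>f(z) = z exp (Q(z))\<close>, then \<open>z f'/f = 1 + z Q' = q\<close>. Conversely, if \<open>z f' = q f\<close>, then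
  \<open>(f(z)/z) exp (-Q(z))\<close> has derivative \<open>0\<close>, hence is constantly equal to its value \<open>f'(0) = 1\<close>
  at the origin.\<close>

text \<open>Since \<open>q 0 = 1\<close>, the integrand has a removable singularity at the origin,
  filled by \<open>deriv q 0\<close>. The resulting holomorphic function has a primitive on the
  convex disk, and on the disk the radial integral is that primitive shifted to vanish at
  \<open>0\<close>.\<close>

lemma radial_integral_has_field_derivative:
  assumes q: "q holomorphic_on unit_disk" and q0: "q 0 = 1" and z: "z \<in> unit_disk"
  shows "(radial_integral q has_field_derivative
            (if z = 0 then deriv q 0 else (q z - 1) / z)) (at z)"
proof -
  define h where "h = (\<lambda>\<zeta>. if \<zeta> = 0 then deriv q 0 else (q \<zeta> - 1) / \<zeta>)"
  have h_holo: "h holomorphic_on unit_disk"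
    using pole_lemma[OF q, of 0] q0 by (simp add: h_def cong: if_cong)
  obtain g where g: "\<And>x. x \<in> unit_disk \<Longrightarrow> (g has_field_derivative h x) (at x within unit_disk)"
    using holomorphic_convex_primitive'[OF convex_ball open_ball h_holo] by blast
  have radial: "radial_integral q x = g x - g 0" if x: "x \<in> unit_disk" for x
  proof (cases "x = 0")
    case True
    then show ?thesis by (simp add: radial_integral_def)
  next
    case False
    have "closed_segment 0 x \<subseteq> unit_disk"
      using x by (intro closed_segment_subset) auto
    then have "(h has_contour_integral (g x - g 0)) (linepath 0 x)"
      using contour_integral_primitive[OF g, of "linepath 0 x"] by simp
    \<comment> \<open>As \<open>x\<close> is nonzero, the segment meets the origin only at parameter
      \<open>0\<close>, so the integrands differ at most at that one parameter.\<close>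
    then have "((\<lambda>\<zeta>. (q \<zeta> - 1) / \<zeta>) has_contour_integral (g x - g 0)) (linepath 0 x)"
      unfolding has_contour_integral_linepath
      by (rule has_integral_spike_finite[rotated -1, where S="{0}"])
         (use False in \<open>auto simp: h_def linepath_def\<close>)
    then show ?thesis
      unfolding radial_integral_def by (rule contour_integral_unique)
  qed
  have "(g has_field_derivative h z) (at z)"
    using g[OF z] at_within_open[OF z open_ball] by simp
  then have "((\<lambda>x. g x - g 0) has_field_derivative h z) (at z)"
    by (auto intro!: derivative_eq_intros)
  then have "(radial_integral q has_field_derivative h z) (at z)"
    by (rule has_field_derivative_transform_within_open[OF _ open_ball z]) (simp add: radial)
  then show ?thesis by (simp add: h_def)
qed

lemma radial_integral_0 [simp]: "radial_integral q 0 = 0"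
  by (simp add: radial_integral_def)

lemma subordinate_at_0: "f \<prec>\<^sub>D g \<Longrightarrow> f 0 = g 0"
  by (force simp: subordinate_def)

text \<open>Here \<open>f'\<close> is a second function, not a derivative. The lemma is for passing
  from \<open>q\<close> to the quotient of \<open>f\<close>, which are related on the disk
  only.\<close>

lemma subordinate_cong:
  assumes "f \<prec>\<^sub>D g" and eq: "\<And>z. z \<in> unit_disk \<Longrightarrow> f' z = f z"
  shows "f' \<prec>\<^sub>D g"
proof -
  have "f' holomorphic_on unit_disk"
    using assms(1) holomorphic_cong[OF refl eq, of unit_disk] by (simp add: subordinate_def)
  then show ?thesis
    using assms unfolding subordinate_def by (metis (no_types, lifting))
qed

lemma log_deriv_quotient_mult_exp_radial:
  assumes q: "q holomorphic_on unit_disk" and q0: "q 0 = 1" and z: "z \<in> unit_disk"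
    and f: "\<And>z. z \<in> unit_disk \<Longrightarrow> f z = z * exp (radial_integral q z)"
  shows "log_deriv_quotient f z = q z"
proof (cases "z = 0")
  case True
  then show ?thesis by (simp add: log_deriv_quotient_def q0)
next
  case False
  have "(radial_integral q has_field_derivative (q z - 1) / z) (at z)"
    using radial_integral_has_field_derivative[OF q q0 z] False by simp
  then have "((\<lambda>x. x * exp (radial_integral q x)) has_field_derivative
               q z * exp (radial_integral q z)) (at z)"
    using False by (auto intro!: derivative_eq_intros simp: field_simps)
  then have "(f has_field_derivative q z * exp (radial_integral q z)) (at z)"
    by (rule has_field_derivative_transform_within_open[OF _ open_ball z]) (simp add: f)
  \<comment> \<open>The exponential has no zeros, so \<open>f z\<close> is nonzero here and the
    division is genuine.\<close>
  then show ?thesis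
    using False f[OF z] by (simp add: log_deriv_quotient_def DERIV_imp_deriv)
qed

text \<open>Near the origin \<open>f\<close> vanishes only at \<open>0\<close>, so the equation holds there without the junk
  value \<open>x / 0 = 0\<close>; the identity theorem extends it to the disk.\<close>
lemma log_deriv_quotient_mult:
  assumes f: "f \<in> normalized_analytic"
    and q: "log_deriv_quotient f holomorphic_on unit_disk" and z: "z \<in> unit_disk"
  shows "z * deriv f z = log_deriv_quotient f z * f z"
proof -
  have holo: "f holomorphic_on unit_disk" and f0: "f 0 = 0" and df0: "deriv f 0 = 1"
    using f by (auto simp: normalized_analytic_def)
  obtain r where r: "r > 0" "ball 0 r \<subseteq> unit_disk" "inj_on f (ball 0 r)"
    using has_complex_derivative_locally_injective[OF holo _ open_ball, of 0] df0 by auto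
  have near: "x * deriv f x = log_deriv_quotient f x * f x" if "x \<in> ball 0 r" for x
  proof (cases "x = 0")
    case False
    then have "f x \<noteq> 0"
      using inj_onD[OF r(3), of x 0] that r(1) f0 by auto
    then show ?thesis using False by (simp add: log_deriv_quotient_def)
  qed (simp add: f0)
  show ?thesis
    by (rule analytic_continuation_open[of "ball 0 r" unit_disk])
       (use r z near in \<open>auto intro!: holomorphic_intros holo q\<close>)
qed

text \<open>Multiplying by \<open>exp (- Q z)\<close> avoids a logarithm of \<open>f z / z\<close>,
  so zeros of \<open>f\<close> need not be excluded beforehand.\<close>

lemma eq_mult_exp_radial:
  assumes f: "f \<in> normalized_analytic" and q: "log_deriv_quotient f holomorphic_on unit_disk"
    and z: "z \<in> unit_disk"
  shows "f z = z * exp (radial_integral (log_deriv_quotient f) z)"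
proof -
  define Q where "Q = radial_integral (log_deriv_quotient f)"
  define F where "F = (\<lambda>z. if z = 0 then 1 else f z / z)"
  define G where "G = (\<lambda>z. F z * exp (- Q z))"
  have holo: "f holomorphic_on unit_disk" and f0: "f 0 = 0" and df0: "deriv f 0 = 1"
    using f by (auto simp: normalized_analytic_def)
  have q0: "log_deriv_quotient f 0 = 1" by (simp add: log_deriv_quotient_def)
  note dQ = radial_integral_has_field_derivative[OF q q0, folded Q_def]
  have "F holomorphic_on unit_disk"
    using pole_lemma[OF holo, of 0] f0 df0 by (simp add: F_def cong: if_cong)
  then have "continuous_on unit_disk F"
    by (rule holomorphic_on_imp_continuous_on)
  moreover have "continuous_on unit_disk Q"
    using dQ by (meson DERIV_isCont continuous_at_imp_continuous_on)
  ultimately have cont: "continuous_on unit_disk G"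
    unfolding G_def by (intro continuous_intros)
  have dG: "(G has_field_derivative 0) (at x)" if x: "x \<in> unit_disk - {0}" for x
  proof -
    have x0: "x \<noteq> 0" and xD: "x \<in> unit_disk" using x by auto
    have df: "(f has_field_derivative deriv f x) (at x)"
      using holomorphic_derivI[OF holo open_ball xD] .
    have dQx: "(Q has_field_derivative (log_deriv_quotient f x - 1) / x) (at x)"
      using dQ[OF xD] x0 by simp
    \<comment> \<open>Up to the factor \<open>exp (- Q x) / x ^ 2\<close>, the left side is the
      derivative of \<open>f z / z * exp (- Q z)\<close> at \<open>x\<close>.\<close>
    have "x * deriv f x - f x - (log_deriv_quotient f x - 1) * f x = 0"
      using log_deriv_quotient_mult[OF f q xD] by (simp add: algebra_simps)
    then have "((\<lambda>z. f z / z * exp (- Q z)) has_field_derivative 0) (at x)"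
      using x0 by (auto intro!: derivative_eq_intros df dQx simp: field_simps)
    then show ?thesis
      by (rule has_field_derivative_transform_within_open[where S="unit_disk - {0}"])
         (use x in \<open>auto simp: G_def F_def\<close>)
  qed
  \<comment> \<open>The derivative is known only off the origin; continuity of \<open>G\<close>
    bridges this single exceptional point.\<close>
  obtain c where c: "\<And>x. x \<in> unit_disk \<Longrightarrow> G x = c"
    using DERIV_zero_connected_constant[of unit_disk "{0}" G] cont dG by auto
  have "G z = G 0" using c z by simp
  also have "G 0 = 1" by (simp add: G_def F_def Q_def)
  finally show ?thesis
    using f0 by (cases "z = 0") (auto simp: G_def F_def Q_def exp_minus field_simps)
qed

theorem theorem2p1:
  fixes f :: "complex \<Rightarrow> complex"
  assumes "f \<in> normalized_analytic"
  shows "f \<in> starlike_Ne \<longleftrightarrow>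
    (\<exists>q. q holomorphic_on unit_disk \<and> q \<prec>\<^sub>D phi_Ne \<and>
         (\<forall>z\<in>unit_disk. f z = z * exp (radial_integral q z)))"
proof
  assume "f \<in> starlike_Ne"
  then have sub: "log_deriv_quotient f \<prec>\<^sub>D phi_Ne"
    by (simp add: starlike_Ne_def)
  then have "log_deriv_quotient f holomorphic_on unit_disk"
    by (simp add: subordinate_def)
  with sub show "\<exists>q. q holomorphic_on unit_disk \<and> q \<prec>\<^sub>D phi_Ne \<and>
         (\<forall>z\<in>unit_disk. f z = z * exp (radial_integral q z))"
    using eq_mult_exp_radial[OF assms] by blast
next
  assume "\<exists>q. q holomorphic_on unit_disk \<and> q \<prec>\<^sub>D phi_Ne \<and>
         (\<forall>z\<in>unit_disk. f z = z * exp (radial_integral q z))"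
  then obtain q where q: "q holomorphic_on unit_disk" "q \<prec>\<^sub>D phi_Ne"
    and f: "\<And>z. z \<in> unit_disk \<Longrightarrow> f z = z * exp (radial_integral q z)" by blast
  \<comment> \<open>The Schwarz function fixes \<open>0\<close>, so \<open>q\<close> takes there the
    value \<open>phi_Ne 0\<close>.\<close>
  have "q 0 = 1" using subordinate_at_0[OF q(2)] by (simp add: phi_Ne_def)
  then have "log_deriv_quotient f \<prec>\<^sub>D phi_Ne"
    using subordinate_cong[OF q(2)] log_deriv_quotient_mult_exp_radial[OF q(1)] f by blast
  with assms show "f \<in> starlike_Ne" by (simp add: starlike_Ne_def)
qed

end
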